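(* Let $d\geqslant 5$ be an odd integer and let $r$ be an even integer with $\gcd(d,r)=1$. Let $n>1$ be an odd integer with $n\equiv -r\pmod{d}$ and $n\geqslant \max\{r,d-r\}$. Then \[ \sum_{k=0}^{n-1}[2dk+r]_{q^2}\frac{(q^{2r};q^{2d})_k^d}{(q^{2d};q^{2d})_k^d}q^{d(d-r-2)k} \equiv 0\pmod{\Phi_n(q)^2}. \]
   Context: $q$ is an indeterminate. The $q$-shifted factorial is $(a;q)_k=(1-a)(1-aq)\cdots(1-aq^{k-1})$ (with $(a;q)_0=1$), and $(a;q^{2d})_k$ is defined analogously with base $q^{2d}$. For any integer $m$ (including negative $m$), $[m]_{q^2}=(1-q^{2m})/(1-q^2)$. $\Phi_n(q)$ denotes the $n$-th cyclotomic polynomial. A congruence of rational functions modulo a polynomial $P(q)$, where the denominators are coprime to $P(q)$, means that $P(q)$ divides the numerator of the difference in lowest terms. *)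

theory Defs
  imports "HOL-Computational_Algebra.Computational_Algebra" Complex_Main
begin

type_synonym ratfun = "complex poly fract"

definition qvar :: ratfun where
  "qvar = to_fract [:0, 1:]"

definition qpoch :: "ratfun \<Rightarrow> ratfun \<Rightarrow> nat \<Rightarrow> ratfun" where
  "qpoch a b k = (\<Prod>j<k. 1 - a * b ^ j)"

definition qint :: "ratfun \<Rightarrow> int \<Rightarrow> ratfun" where
  "qint x m = (1 - x powi m) / (1 - x)"

definition cyclotomic :: "nat \<Rightarrow> complex poly" where
  "cyclotomic n = (\<Prod>k\<in>{k. k < n \<and> coprime k n}.
      [: - exp (2 * of_real pi * \<i> * of_nat k / of_nat n), 1 :])"

definition ratfun_cong_zero :: "ratfun \<Rightarrow> complex poly \<Rightarrow> bool" where
  "ratfun_cong_zero f P \<longleftrightarrow>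
     (\<exists>a b. b \<noteq> 0 \<and> f = to_fract a / to_fract b \<and> coprime b P \<and> P dvd a)"

end

theory Submission
  imports Defs "HOL-Analysis.Complex_Transcendental" "HOL-Computational_Algebra.Field_as_Ring"
begin

text \<open>
  Put \<open>Q = q^(2d)\<close>, \<open>a = q^(2r)\<close>, \<open>n = d s - r\<close> (so \<open>s\<close> is odd) and \<open>N = n - s\<close>, and let \<open>P\<close> be the
  cyclotomic polynomial. The summand \<open>T k\<close> is very-well-poised with respect to \<open>a\<close>; it is divisible
  by \<open>P^d\<close> for \<open>k > N\<close>, and \<open>T (N - k) = - T k\<close> modulo \<open>P\<close>. Replacing one parameter \<open>a\<close> by \<open>Q^(-N)\<close>
  and \<open>d - 2\<close> further ones by \<open>a q^n\<close> multiplies \<open>T k\<close> by a factor \<open>R k\<close> that is \<open>1\<close> modulo \<open>P\<close> and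
  satisfies \<open>R (N - k) = R k\<close> modulo \<open>P^2\<close>. Hence the changes \<open>T k (R k - 1)\<close> at \<open>k\<close> and \<open>N - k\<close> cancel
  modulo \<open>P^2\<close>. The modified sum vanishes identically: it is an \<open>N\<close>-th divided difference, at the
  nodes \<open>Q^(-k) + a Q^k\<close>, of a polynomial of degree \<open>(d - 2)(s - 1)/2 < N\<close>.
\<close>

subsection \<open>A terminating very-well-poised sum\<close>

text \<open>Lagrange interpolation at the \<open>N + 1\<close> nodes reproduces \<open>f\<close>.
  The sum is the coefficient of degree \<open>N\<close> of the interpolant, which is zero because
  \<open>f\<close> has smaller degree.\<close>

lemma divided_difference_eq_0:
  fixes y :: "nat \<Rightarrow> 'a::field" and f :: "'a poly"
  assumes inj: "inj_on y {..N}" and deg: "degree f < N"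
  shows "(\<Sum>k\<le>N. poly f (y k) / (\<Prod>j\<in>{..N}-{k}. y k - y j)) = 0"
proof -
  define c where "c k = poly f (y k) / (\<Prod>j\<in>{..N}-{k}. y k - y j)" for k
  define P where "P k = (\<Prod>j\<in>{..N}-{k}. [:- y j, 1:])" for k
  define L where "L = (\<Sum>k\<le>N. smult (c k) (P k))"
  have degP: "degree (P k) = N" if "k \<le> N" for k
    using that by (simp add: P_def degree_prod_eq_sum_degree)
  have lcP: "lead_coeff (P k) = 1" for k
    by (simp add: P_def lead_coeff_prod)
  have PP: "poly (P k) (y i) = (if i = k then (\<Prod>j\<in>{..N}-{k}. y k - y j) else 0)"
    if "i \<le> N" for i k
    using that by (auto simp: P_def poly_prod)
  have nz: "(\<Prod>j\<in>{..N}-{k}. y k - y j) \<noteq> 0" if "k \<le> N" for k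
    using that inj by (auto simp: inj_on_def)
  have "poly L (y i) = poly f (y i)" if "i \<le> N" for i
  proof -
    have "poly L (y i) = (\<Sum>k\<le>N. if i = k then poly f (y i) else 0)"
      unfolding L_def poly_sum
      by (rule sum.cong) (use that nz in \<open>auto simp: PP c_def\<close>)
    then show ?thesis
      using that by simp
  qed
  moreover have "degree L \<le> N"
    unfolding L_def by (rule degree_sum_le) (auto intro: order.trans[OF degree_smult_le] simp: degP)
  ultimately have "L = f"
    using deg inj by (intro poly_eqI_degree[of "y ` {..N}"]) (auto simp: card_image)
  then have "coeff L N = 0"
    using deg by (simp add: coeff_eq_0)
  moreover have "coeff L N = (\<Sum>k\<le>N. c k)"
    unfolding L_def coeff_sum using lcP degP by (intro sum.cong) (auto simp: )
  ultimately show ?thesis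
    by (simp add: c_def)
qed

lemma prod_lessThan_add:
  fixes g :: "nat \<Rightarrow> 'a::comm_monoid_mult"
  shows "prod g {..<m + n} = prod g {..<m} * (\<Prod>j<n. g (m + j))"
  by (induction n) (simp_all add: ac_simps)

text \<open>Both sides are the product of \<open>1 - a * Q ^ j\<close> over
  \<open>j \<le> N + k\<close>, cut after \<open>k\<close> factors on the left and after
  \<open>N + 1\<close> on the right; \<open>1 - a * Q ^ (2 * k)\<close> restores the omitted index
  \<open>j = k\<close>.\<close>

lemma prod_remove_shift:
  fixes a Q :: "'a::field"
  assumes "k \<le> N"
  shows "(\<Prod>j\<in>{..N}-{k}. 1 - a * Q ^ (j + k)) * (1 - a * Q ^ (2 * k)) * (\<Prod>j<k. 1 - a * Q ^ j)
    = (\<Prod>j\<le>N. 1 - a * Q ^ j) * (\<Prod>j<k. 1 - a * Q ^ (N + 1 + j))"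
proof -
  let ?g = "\<lambda>j. 1 - a * Q ^ j"
  have "(\<Prod>j\<in>{..N}-{k}. ?g (j + k)) * ?g (2 * k) = (\<Prod>j\<le>N. ?g (j + k))"
    using assms by (subst prod.remove[of "{..N}" k]) (auto simp flip: mult_2)
  moreover have "(\<Prod>j<k. ?g j) * (\<Prod>j\<le>N. ?g (j + k)) = (\<Prod>j<k + (N + 1). ?g j)"
    unfolding prod_lessThan_add[of ?g k] by (simp add: lessThan_Suc_atMost add.commute)
  moreover have "(\<Prod>j\<le>N. ?g j) * (\<Prod>j<k. ?g (N + 1 + j)) = (\<Prod>j<(N + 1) + k. ?g j)"
    by (subst prod_lessThan_add) (simp add: lessThan_Suc_atMost)
  ultimately show ?thesis
    by (simp add: ac_simps)
qed

text \<open>Differences with \<open>j < k\<close> give the \<open>Q\<close>-factorial of length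
  \<open>k\<close>. Those with \<open>j > k\<close> give an initial segment of the last product,
  whose remaining \<open>k\<close> factors are the factors \<open>1 - Q ^ j / Q ^ N\<close> in
  reverse order. The extracted powers of \<open>Q\<close> have total exponent
  \<open>k * k + k * (N - k) = N * k\<close>.\<close>

lemma prod_node_differences:
  fixes Q :: "'a::field"
  assumes "k \<le> N" and [simp]: "Q \<noteq> 0"
  shows "(\<Prod>j\<in>{..N}-{k}. 1 / Q ^ k - 1 / Q ^ j) * (\<Prod>j<k. 1 - Q ^ j / Q ^ N) * Q ^ (N * k)
    = (\<Prod>j<k. 1 - Q ^ (j + 1)) * (\<Prod>j<N. 1 - 1 / Q ^ (j + 1))"
proof -
  have split: "{..N}-{k} = {..<k} \<union> {k<..N}" using assms by auto
  have 1: "(\<Prod>j<k. 1 / Q ^ k - 1 / Q ^ j) = (\<Prod>j<k. 1 - Q ^ (j + 1)) / Q ^ (k * k)"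
  proof -
    have "(\<Prod>j<k. 1 / Q ^ k - 1 / Q ^ j) = (\<Prod>j<k. (1 - Q ^ (k - j)) / Q ^ k)"
      by (rule prod.cong) (auto simp: field_simps simp flip: power_add)
    also have "\<dots> = (\<Prod>j<k. 1 - Q ^ (k - j)) / Q ^ (k * k)"
      by (simp add: prod_dividef power_mult)
    also have "(\<Prod>j<k. 1 - Q ^ (k - j)) = (\<Prod>j<k. 1 - Q ^ (j + 1))"
      by (subst prod.nat_diff_reindex[symmetric]) (auto intro!: prod.cong)
    finally show ?thesis .
  qed
  have 2: "(\<Prod>j\<in>{k<..N}. 1 / Q ^ k - 1 / Q ^ j) = (\<Prod>j<N - k. 1 - 1 / Q ^ (j + 1)) / Q ^ (k * (N - k))"
  proof -
    have "(\<Prod>j\<in>{k<..N}. 1 / Q ^ k - 1 / Q ^ j) = (\<Prod>j<N - k. 1 / Q ^ k - 1 / Q ^ (k + (j + 1)))"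
      by (rule prod.reindex_bij_witness[of _ "\<lambda>j. k + (j + 1)" "\<lambda>j. j - k - 1"]) auto
    also have "\<dots> = (\<Prod>j<N - k. (1 - 1 / Q ^ (j + 1)) / Q ^ k)"
      by (rule prod.cong) (auto simp: field_simps power_add)
    finally show ?thesis by (simp add: prod_dividef power_mult)
  qed
  have 3: "(\<Prod>j<k. 1 - Q ^ j / Q ^ N) = (\<Prod>j<k. 1 - 1 / Q ^ ((N - k) + j + 1))"
  proof -
    have "(\<Prod>j<k. 1 - Q ^ j / Q ^ N) = (\<Prod>j<k. 1 - 1 / Q ^ (N - j))"
    proof (rule prod.cong[OF refl])
      fix j assume "j \<in> {..<k}"
      then have "Q ^ N = Q ^ (N - j) * Q ^ j" using assms by (simp flip: power_add)
      then show "1 - Q ^ j / Q ^ N = 1 - 1 / Q ^ (N - j)" by simp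
    qed
    also have "\<dots> = (\<Prod>j<k. 1 - 1 / Q ^ ((N - k) + j + 1))"
      by (subst prod.nat_diff_reindex[symmetric]) (use assms in \<open>auto intro!: prod.cong simp: Suc_diff_le\<close>)
    finally show ?thesis .
  qed
  have 4: "(\<Prod>j<N. 1 - 1 / Q ^ (j + 1)) = (\<Prod>j<N - k. 1 - 1 / Q ^ (j + 1)) * (\<Prod>j<k. 1 - 1 / Q ^ ((N - k) + j + 1))"
    using prod_lessThan_add[of "\<lambda>j. 1 - 1 / Q ^ (j + 1)" "N - k" k] assms by simp
  have 5: "Q ^ (N * k) = Q ^ (k * k) * Q ^ (k * (N - k))"
    using assms by (simp flip: power_add add: mult.commute distrib_left[symmetric])
  show ?thesis
    unfolding split 4 3 5
    by (subst prod.union_disjoint) (auto simp: 1 2)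
qed


text \<open>For the nodes \<open>y k = 1 / Q ^ k + a * Q ^ k\<close>, the difference
  \<open>y k - y j\<close> factors as
  \<open>(1 / Q ^ k - 1 / Q ^ j) * (1 - a * Q ^ (j + k))\<close>. Hence the weight is a constant
  over the product of node differences, and the sum is a multiple of a divided difference.\<close>

lemma well_poised_sum_eq_0:
  fixes a Q :: "'a::field"
  assumes [simp]: "Q \<noteq> 0" and Q: "\<And>j. 0 < j \<Longrightarrow> Q ^ j \<noteq> 1" and aQ: "\<And>j. a * Q ^ j \<noteq> 1"
    and deg: "degree f < N"
  shows "(\<Sum>k\<le>N. (1 - a * Q ^ (2 * k)) * ((\<Prod>j<k. 1 - a * Q ^ j) / (\<Prod>j<k. 1 - Q ^ (j + 1)))
    * ((\<Prod>j<k. 1 - Q ^ j / Q ^ N) / (\<Prod>j<k. 1 - a * Q ^ (N + 1 + j)))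
    * Q ^ (N * k) * poly f (1 / Q ^ k + a * Q ^ k)) = 0"
proof -
  define y where "y k = 1 / Q ^ k + a * Q ^ k" for k
  define C where "C = (\<Prod>j\<le>N. 1 - a * Q ^ j) * (\<Prod>j<N. 1 - 1 / Q ^ (j + 1))"
  have diff: "y k - y j = (1 / Q ^ k - 1 / Q ^ j) * (1 - a * Q ^ (j + k))" for j k
    by (simp add: y_def field_simps power_add)
  have inj: "Q ^ i \<noteq> Q ^ j" if "i < j" for i j
  proof
    assume "Q ^ i = Q ^ j"
    moreover have "Q ^ j = Q ^ i * Q ^ (j - i)" using that by (simp flip: power_add)
    ultimately show False using Q[of "j - i"] that by simp
  qed
  have "y k \<noteq> y j" if "j \<noteq> k" for j k
  proof -
    have "1 / Q ^ k - 1 / Q ^ j \<noteq> 0"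
      using that inj[of j k] inj[of k j] by (cases j k rule: linorder_cases) auto
    then have "y k - y j \<noteq> 0"
      unfolding diff using aQ[of "j + k"] by simp
    then show ?thesis by simp
  qed
  then have inj_y: "inj_on y {..N}" by (metis inj_onI)
  \<comment> \<open>The first two premises have the shape of \<open>prod_remove_shift\<close> and
    \<open>prod_node_differences\<close>, so that \<open>weight\<close> becomes a cancellation
    between these two products.\<close>
  have cancel: "w * (A / B') * (B / D) * u * (Y * X) = G * H"
    if "X * w * A = G * D" "Y * B * u = B' * H" "B' \<noteq> 0" "D \<noteq> 0" for X w A G D Y B u B' H :: 'a
  proof -
    have "w * (A / B') * (B / D) * u * (Y * X) = (X * w * A) * (Y * B * u) / (B' * D)" by simp
    also have "\<dots> = G * H" using that(3,4) unfolding that(1,2) by simp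
    finally show ?thesis .
  qed
  have weight: "(1 - a * Q ^ (2 * k)) * ((\<Prod>j<k. 1 - a * Q ^ j) / (\<Prod>j<k. 1 - Q ^ (j + 1)))
      * ((\<Prod>j<k. 1 - Q ^ j / Q ^ N) / (\<Prod>j<k. 1 - a * Q ^ (N + 1 + j))) * Q ^ (N * k)
      = C / (\<Prod>j\<in>{..N}-{k}. y k - y j)" (is "?W = _") if "k \<le> N" for k
  proof -
    have nz: "(\<Prod>j<k. 1 - Q ^ (j + 1)) \<noteq> 0" "(\<Prod>j<k. 1 - a * Q ^ (N + 1 + j)) \<noteq> 0"
      using Q aQ by (auto simp del: power_Suc)
    have "(\<Prod>j\<in>{..N}-{k}. y k - y j) \<noteq> 0"
      using \<open>\<And>k j. j \<noteq> k \<Longrightarrow> y k \<noteq> y j\<close> by auto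
    moreover have "?W * (\<Prod>j\<in>{..N}-{k}. y k - y j) = C"
      unfolding diff prod.distrib C_def
      by (rule cancel[OF prod_remove_shift[OF that] prod_node_differences[OF that] nz]) (rule assms)
    ultimately show ?thesis by (simp add: field_simps)
  qed
  have "(\<Sum>k\<le>N. (1 - a * Q ^ (2 * k)) * ((\<Prod>j<k. 1 - a * Q ^ j) / (\<Prod>j<k. 1 - Q ^ (j + 1)))
    * ((\<Prod>j<k. 1 - Q ^ j / Q ^ N) / (\<Prod>j<k. 1 - a * Q ^ (N + 1 + j)))
    * Q ^ (N * k) * poly f (1 / Q ^ k + a * Q ^ k))
    = C * (\<Sum>k\<le>N. poly f (y k) / (\<Prod>j\<in>{..N}-{k}. y k - y j))"
    unfolding sum_distrib_left by (rule sum.cong) (simp_all only: atMost_iff weight, simp_all add: y_def)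
  then show ?thesis
    using divided_difference_eq_0[OF inj_y deg] by simp
qed

text \<open>Exchanging the roles of \<open>k\<close> and \<open>2 * m\<close> turns the quotient
  into a product of the \<open>2 * m\<close> factors \<open>1 - b * Q ^ (k + i)\<close> over a
  constant. By \<open>bal\<close>, the parameters \<open>b * Q ^ i\<close> and
  \<open>b * Q ^ (2 * m - 1 - i)\<close> have product \<open>a\<close>, so this pair of factors is
  \<open>Q ^ k\<close> times a linear polynomial in the node, with root \<open>c + a / c\<close> for
  \<open>c = b * Q ^ i\<close>.\<close>

lemma well_poised_factor_poly:
  fixes a b Q :: "'a::field"
  assumes [simp]: "Q \<noteq> 0" "b \<noteq> 0" and bal: "b ^ 2 * Q ^ (2 * m) = a * Q" and b: "\<And>j. b * Q ^ j \<noteq> 1"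
  obtains f where "degree f = m"
    "\<And>k. (\<Prod>j<k. 1 - b * Q ^ (2 * m + j)) / (\<Prod>j<k. 1 - b * Q ^ j) = Q ^ (m * k) * poly f (1 / Q ^ k + a * Q ^ k)"
proof -
  let ?g = "\<lambda>j. 1 - b * Q ^ j"
  define f where "f = smult (1 / (\<Prod>j<2 * m. ?g j)) (\<Prod>i<m. [:- (b * Q ^ i + a / (b * Q ^ i)), 1:])"
  have nz: "(\<Prod>j<k. ?g j) \<noteq> 0" for k
    using b by auto
  have "degree f = m"
    using nz[of "2 * m"] by (simp add: f_def degree_prod_eq_sum_degree)
  moreover have "(\<Prod>j<k. ?g (2 * m + j)) / (\<Prod>j<k. ?g j) = Q ^ (m * k) * poly f (1 / Q ^ k + a * Q ^ k)" for k
  proof -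
    have pair: "?g (k + i) * ?g (k + (2 * m - 1 - i)) = Q ^ k * (1 / Q ^ k + a * Q ^ k - (b * Q ^ i + a / (b * Q ^ i)))"
      if "i < m" for i
    proof -
      have "b ^ 2 * Q ^ i * Q ^ (2 * m - 1 - i) * Q = b ^ 2 * Q ^ (i + (2 * m - 1 - i) + 1)"
        by (simp add: power_add)
      also have "i + (2 * m - 1 - i) + 1 = 2 * m" using that by simp
      finally have "b ^ 2 * Q ^ i * Q ^ (2 * m - 1 - i) = a"
        using bal by (metis \<open>Q \<noteq> 0\<close> mult_right_cancel)
      then have "b * Q ^ (2 * m - 1 - i) = a / (b * Q ^ i)"
        by (simp add: field_simps power2_eq_square)
      moreover have "?g (k + (2 * m - 1 - i)) = 1 - b * Q ^ (2 * m - 1 - i) * Q ^ k"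
        by (simp add: power_add ac_simps)
      ultimately have 1: "?g (k + (2 * m - 1 - i)) = 1 - a / (b * Q ^ i) * Q ^ k"
        by simp
      have 2: "?g (k + i) = 1 - b * Q ^ i * Q ^ k"
        by (simp add: power_add ac_simps)
      have 3: "(1 - c * X) * (1 - a / c * X) = X * (1 / X + a * X - (c + a / c))"
        if "c \<noteq> 0" "X \<noteq> 0" for c X
        using that by (simp add: field_simps)
      show ?thesis
        unfolding 1 2 by (rule 3) simp_all
    qed
    have "(\<Prod>j<2 * m. ?g (k + j)) = (\<Prod>i<m. ?g (k + i)) * (\<Prod>i<m. ?g (k + (m + i)))"
      unfolding mult_2 prod_lessThan_add ..
    also have "(\<Prod>i<m. ?g (k + (m + i))) = (\<Prod>i<m. ?g (k + (2 * m - 1 - i)))"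
      by (subst prod.nat_diff_reindex[symmetric]) (auto intro!: prod.cong)
    also have "(\<Prod>i<m. ?g (k + i)) * \<dots> = (\<Prod>i<m. Q ^ k * (1 / Q ^ k + a * Q ^ k - (b * Q ^ i + a / (b * Q ^ i))))"
      unfolding prod.distrib[symmetric] by (rule prod.cong) (simp_all only: pair lessThan_iff)
    also have "\<dots> = Q ^ (m * k) * (\<Prod>i<m. 1 / Q ^ k + a * Q ^ k - (b * Q ^ i + a / (b * Q ^ i)))"
      unfolding prod.distrib by (simp add: power_mult mult.commute[of m])
    also have "\<dots> = Q ^ (m * k) * poly f (1 / Q ^ k + a * Q ^ k) * (\<Prod>j<2 * m. ?g j)"
      using nz[of "2 * m"] by (simp add: f_def poly_prod algebra_simps)
    finally have "(\<Prod>j<2 * m. ?g (k + j)) = \<dots>" .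
    moreover have "(\<Prod>j<2 * m. ?g j) * (\<Prod>j<k. ?g (2 * m + j)) = (\<Prod>j<k. ?g j) * (\<Prod>j<2 * m. ?g (k + j))"
      using prod_lessThan_add[of ?g "2 * m" k] prod_lessThan_add[of ?g k "2 * m"] by (simp add: add.commute)
    ultimately show ?thesis
      using nz[of "2 * m"] nz[of k] by (simp add: field_simps)
  qed
  ultimately show thesis
    by (rule that)
qed

subsection \<open>Congruences in a local ring\<close>

text \<open>
  \<open>S\<close> plays the role of the local ring of rational functions whose denominator is coprime to the
  cyclotomic polynomial \<open>p\<close>.
\<close>

locale root_localization =
  fixes S :: "'a::field set" and p q :: 'a and n :: nat
  assumes one_mem: "1 \<in> S"
    and diff_mem: "x \<in> S \<Longrightarrow> y \<in> S \<Longrightarrow> x - y \<in> S"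
    and mult_mem: "x \<in> S \<Longrightarrow> y \<in> S \<Longrightarrow> x * y \<in> S"
    and q_mem: "q \<in> S" and inverse_q_mem: "inverse q \<in> S"
    and inverse_2_mem: "inverse 2 \<in> S"
    and two_neq_0: "(2 :: 'a) \<noteq> 0" and q_neq_0: "q \<noteq> 0"
    and q_powi_neq_1: "i \<noteq> 0 \<Longrightarrow> q powi i \<noteq> 1"
    and vanish: "int n dvd i \<Longrightarrow> \<exists>z\<in>S. 1 - q powi i = p * z"
    and unit: "\<not> int n dvd i \<Longrightarrow> inverse (1 - q powi i) \<in> S"
begin

text \<open>Congruence modulo \<open>p ^ i\<close>. The two sides need not lie in \<open>S\<close>;
  only their difference is constrained, so the multiplicative rules carry membership
  premises.\<close>

definition cg :: "nat \<Rightarrow> 'a \<Rightarrow> 'a \<Rightarrow> bool" where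
  "cg i x y \<longleftrightarrow> (\<exists>z\<in>S. x - y = p ^ i * z)"

lemma zero_mem: "0 \<in> S"
  using diff_mem[OF one_mem one_mem] by simp

lemma minus_mem: "x \<in> S \<Longrightarrow> - x \<in> S"
  using diff_mem[OF zero_mem] by fastforce

lemma add_mem: "x \<in> S \<Longrightarrow> y \<in> S \<Longrightarrow> x + y \<in> S"
  using diff_mem[OF _ minus_mem] by fastforce

lemma prod_mem: "(\<And>j. j \<in> J \<Longrightarrow> g j \<in> S) \<Longrightarrow> prod g J \<in> S"
  by (induction J rule: infinite_finite_induct) (auto simp: one_mem mult_mem)

lemma power_mem: "x \<in> S \<Longrightarrow> x ^ i \<in> S"
  by (induction i) (auto simp: one_mem mult_mem)

lemma powi_mem: "q powi i \<in> S"
  by (auto simp: power_int_def power_mem q_mem inverse_q_mem)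

lemma div_mem: "x \<in> S \<Longrightarrow> inverse y \<in> S \<Longrightarrow> x / y \<in> S"
  by (simp add: divide_inverse mult_mem)

lemma powi_add: "q powi (i + j) = q powi i * q powi j"
  using q_neq_0 by (simp add: power_int_add)

lemma cg_refl: "cg i x x"
  using zero_mem by (auto simp: cg_def)

lemma cg_sym: "cg i x y \<Longrightarrow> cg i y x"
  unfolding cg_def by (metis minus_diff_eq minus_mem mult_minus_right)

lemma cg_trans [trans]: "cg i x y \<Longrightarrow> cg i y z \<Longrightarrow> cg i x z"
  unfolding cg_def by (metis add_mem diff_add_cancel add_diff_eq distrib_left)

lemma cg_add: "cg i x y \<Longrightarrow> cg i x' y' \<Longrightarrow> cg i (x + x') (y + y')"
  unfolding cg_def by (metis add_mem add_diff_add distrib_left)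

lemma cg_minus: "cg i x y \<Longrightarrow> cg i (- x) (- y)"
  unfolding cg_def by (metis minus_diff_minus minus_mem mult_minus_right)

lemma cg_sum: "(\<And>j. j \<in> J \<Longrightarrow> cg i (g j) (h j)) \<Longrightarrow> cg i (sum g J) (sum h J)"
  by (induction J rule: infinite_finite_induct) (auto intro: cg_refl cg_add)

lemma cg_mult_left: "cg i x y \<Longrightarrow> z \<in> S \<Longrightarrow> cg i (z * x) (z * y)"
  unfolding cg_def by (metis mult_mem mult.left_commute right_diff_distrib)

lemma cg_mult_right: "cg i x y \<Longrightarrow> z \<in> S \<Longrightarrow> cg i (x * z) (y * z)"
  using cg_mult_left by (simp add: mult.commute)

lemma cg_mult: "cg i x y \<Longrightarrow> cg i x' y' \<Longrightarrow> x' \<in> S \<Longrightarrow> y \<in> S \<Longrightarrow> cg i (x * x') (y * y')"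
  by (blast intro: cg_trans cg_mult_left cg_mult_right)

lemma cg_prod:
  assumes "\<And>j. j \<in> J \<Longrightarrow> cg i (g j) (h j)" "\<And>j. j \<in> J \<Longrightarrow> g j \<in> S" "\<And>j. j \<in> J \<Longrightarrow> h j \<in> S"
  shows "cg i (prod g J) (prod h J)"
  using assms
  by (induction J rule: infinite_finite_induct) (auto intro!: cg_refl cg_mult prod_mem)

lemma cg_power: "cg i x y \<Longrightarrow> x \<in> S \<Longrightarrow> y \<in> S \<Longrightarrow> cg i (x ^ k) (y ^ k)"
  by (induction k) (auto intro!: cg_refl cg_mult power_mem)

text \<open>This is how two congruences modulo \<open>p\<close> combine into one modulo
  \<open>p ^ 2\<close>.\<close>

lemma cg_mult_0: "cg i x 0 \<Longrightarrow> cg j y 0 \<Longrightarrow> cg (i + j) (x * y) 0"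
proof -
  assume "cg i x 0" "cg j y 0"
  then obtain z w where "z \<in> S" "w \<in> S" "x = p ^ i * z" "y = p ^ j * w"
    by (auto simp: cg_def)
  then have "z * w \<in> S" "x * y - 0 = p ^ (i + j) * (z * w)"
    by (simp_all add: mult_mem power_add)
  then show ?thesis
    unfolding cg_def by blast
qed

lemma cg_0_mult_right: "cg i x 0 \<Longrightarrow> z \<in> S \<Longrightarrow> cg i (x * z) 0"
  using cg_mult_right[of i x 0 z] by simp

lemma cg_0_mult_left: "cg i x 0 \<Longrightarrow> z \<in> S \<Longrightarrow> cg i (z * x) 0"
  using cg_mult_left[of i x 0 z] by simp

lemma cg_0_add: "cg i x 0 \<Longrightarrow> cg i y 0 \<Longrightarrow> cg i (x + y) 0"
  using cg_add[of i x 0 y 0] by simp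

lemma cg_0_minus: "cg i x 0 \<Longrightarrow> cg i (- x) 0"
  using cg_minus[of i x 0] by simp

lemma cg_iff_diff: "cg i x y \<longleftrightarrow> cg i (x - y) 0"
  by (simp add: cg_def)

lemma cg_1_powi: "int n dvd i \<Longrightarrow> cg 1 (1 - q powi i) 0"
  using vanish by (simp add: cg_def)

text \<open>Write \<open>U l\<close> and \<open>V l\<close> for the partial products of
  \<open>u\<close> and \<open>v\<close>. The last \<open>l\<close> factors of \<open>U N\<close>,
  reversed, cancel against \<open>V l\<close>, so \<open>U N * V l\<close> is congruent to
  \<open>U (N - l)\<close>. Using this for \<open>l = N - k\<close> and for \<open>l = k\<close>
  links both sides through \<open>U N * V k * V (N - k)\<close>.\<close>

lemma cg_reflect:
  fixes N :: nat
  assumes k: "k \<le> N" and u: "\<And>j. j < N \<Longrightarrow> u j \<in> S" and v: "\<And>j. j < N \<Longrightarrow> v j \<in> S"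
    and uv: "\<And>j. j < N \<Longrightarrow> cg i (u (N - 1 - j) * v j) 1"
  shows "cg i (\<Prod>j<k. u j * v j) (\<Prod>j<N - k. u j * v j)"
proof -
  have half: "cg i (prod u {..<N} * prod v {..<l}) (prod u {..<N - l})" if "l \<le> N" for l
  proof -
    have "prod u {..<(N - l) + l} = prod u {..<N - l} * (\<Prod>j<l. u (N - l + j))"
      by (rule prod_lessThan_add)
    also have "(\<Prod>j<l. u (N - l + j)) = (\<Prod>j<l. u (N - 1 - j))"
      by (subst prod.nat_diff_reindex[symmetric]) (use that in \<open>auto intro!: prod.cong\<close>)
    finally have "prod u {..<N} * prod v {..<l} = prod u {..<N - l} * (\<Prod>j<l. u (N - 1 - j) * v j)"
      using that by (simp add: prod.distrib mult.assoc)
    also have "cg i \<dots> (prod u {..<N - l} * (\<Prod>j<l. 1))"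
      using that by (intro cg_mult_left cg_prod uv) (auto intro!: prod_mem mult_mem u v one_mem)
    finally show ?thesis by simp
  qed
  have pm: "prod u {..<l} \<in> S" "prod v {..<l} \<in> S" if "l \<le> N" for l
    using that u v by (auto intro!: prod_mem)
  have "cg i (prod u {..<N} * prod v {..<N - k}) (prod u {..<k})"
    using half[of "N - k"] k by simp
  then have "cg i (prod u {..<k} * prod v {..<k}) (prod u {..<N} * prod v {..<N - k} * prod v {..<k})"
    using k pm by (intro cg_mult_right[OF cg_sym]) auto
  also have "\<dots> = prod u {..<N} * prod v {..<k} * prod v {..<N - k}"
    by simp
  also have "cg i \<dots> (prod u {..<N - k} * prod v {..<N - k})"
    using k pm by (intro cg_mult_right half) auto
  finally show ?thesis
    by (simp add: prod.distrib)
qed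

end

subsection \<open>The truncated sum and its deformation\<close>

text \<open>The odd cofactor \<open>s\<close> of the overview is written
  \<open>2 * m + 1\<close>.\<close>

locale well_poised_truncated = root_localization S p q n
  for S :: "'a::field set" and p q n +
  fixes d m N :: nat and r :: int
  assumes d_ge: "d \<ge> 3" and d_odd: "odd d" and coprime_d_r: "coprime (int d) r"
    and n_odd: "odd n" and n_eq: "int n = int d * (2 * int m + 1) - r"
    and n_ge: "r \<le> int n" and N_eq: "int N = int n - (2 * int m + 1)"
begin

definition Q :: 'a where "Q = q powi (2 * int d)"
definition a :: 'a where "a = q powi (2 * r)"
definition Z :: 'a where "Z = q powi (int d * (int d - r - 2))"
text \<open>The summand of the theorem times \<open>1 - q ^ 2\<close>, which clears the denominator
  of the \<open>q\<close>-integer.\<close>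

definition T :: "nat \<Rightarrow> 'a" where
  "T k = (1 - a * Q ^ (2 * k)) * ((\<Prod>j<k. 1 - a * Q ^ j) / (\<Prod>j<k. 1 - Q ^ (j + 1))) ^ d * Z ^ k"
text \<open>
  \<open>\<rho> x k\<close> is the factor by which \<open>T k\<close> changes when one of the \<open>d\<close> parameters \<open>a\<close> of the
  well-poised sum is replaced by \<open>a * x\<close>, together with its partner \<open>Q\<close> by \<open>Q / x\<close> and the argument
  \<open>Z\<close> by \<open>Z / x\<close>. The choices of \<open>x\<close> below are made so that \<open>a * x1 = Q powi (- N)\<close>
  terminates the sum at \<open>N\<close>, while \<open>a * x2\<close> is the \<open>Q ^ (2 * m)\<close>-fold of its partner \<open>Q / x2\<close>, which
  turns the corresponding quotients of shifted factorials into polynomials.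
\<close>

definition \<rho> :: "'a \<Rightarrow> nat \<Rightarrow> 'a" where
  "\<rho> x k = (\<Prod>j<k. (1 - a * x * Q ^ j) / (1 - a * Q ^ j) * ((1 - Q ^ (j + 1)) / (x - Q ^ (j + 1))))"
definition x1 :: 'a where "x1 = q powi (int n * (2 - 2 * int d))"
definition x2 :: 'a where "x2 = q powi (int n * 1)"
definition R :: "nat \<Rightarrow> 'a" where "R k = \<rho> x1 k * \<rho> x2 k ^ (d - 2)"

section \<open>Exponents modulo \<open>n\<close>, units and nonzero denominators\<close>

lemma coprime_n_d: "coprime (int n) (2 * int d)"
proof -
  have "coprime (int d) (int n)"
  proof (rule coprimeI)
    fix c assume "c dvd int d" "c dvd int n"
    then have "c dvd int d * (2 * int m + 1) - int n" by (intro dvd_diff dvd_mult2)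
    then have "c dvd r" by (simp add: n_eq)
    with \<open>c dvd int d\<close> show "is_unit c"
      using coprime_d_r by (rule coprime_common_divisor[rotated])
  qed
  moreover have "coprime (int n) 2"
    using n_odd by (simp add: coprime_right_2_iff_odd)
  ultimately show ?thesis
    by (simp add: coprime_commute)
qed

text \<open>This makes \<open>Q\<close> behave like a primitive \<open>n\<close>-th root of unity
  modulo \<open>p\<close>: \<open>1 - Q ^ j\<close> is a unit for \<open>0 < j < n\<close>.\<close>

lemma dvd_2d: "int n dvd 2 * int d * i \<longleftrightarrow> int n dvd i"
  using coprime_n_d by (simp add: coprime_dvd_mult_right_iff)

lemma power_d: "x ^ d = x * x * x ^ (d - 2)" for x :: 'a
proof -
  have "x ^ (2 + (d - 2)) = x * x * x ^ (d - 2)"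
    by (simp add: power_add power2_eq_square)
  moreover have "2 + (d - 2) = d" using d_ge by simp
  ultimately show ?thesis by (simp only:)
qed

lemma N_lt: "N < n"
  using N_eq by linarith

lemma N_even: "even N"
proof -
  have "even (int N)" using n_odd by (simp add: N_eq)
  then show ?thesis by simp
qed

text \<open>The reason for the choice of \<open>N\<close>: \<open>a * Q ^ N\<close> is a power of
  \<open>q ^ n\<close>, hence congruent to \<open>1\<close> modulo \<open>p\<close>.\<close>

lemma r_eq: "r + int d * int N = int n * (int d - 1)"
proof -
  have "2 * int m + 1 = int n - int N" using N_eq by simp
  then have "int n = int d * (int n - int N) - r" using n_eq by metis
  then show ?thesis by (simp add: algebra_simps)
qed

lemma Q_power: "Q ^ j = q powi (2 * int d * int j)"
  by (simp add: Q_def power_int_power')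

lemma aQ: "a * Q ^ j = q powi (2 * r + 2 * int d * int j)"
  by (simp add: Q_power a_def powi_add)

lemma aQ_N: "a * Q ^ N = q powi (2 * int n * (int d - 1))"
  unfolding aQ using r_eq by (intro arg_cong[of _ _ "power_int q"]) (simp add: algebra_simps)

lemma Q_neq_0 [simp]: "Q \<noteq> 0"
  by (simp add: Q_def q_neq_0)

lemma Q_power_neq_1: "0 < j \<Longrightarrow> Q ^ j \<noteq> 1"
  unfolding Q_power using d_ge by (intro q_powi_neq_1) simp

text \<open>An exponent zero would make \<open>d\<close> divide \<open>r\<close>. The inequality
  covers \<open>j = N\<close>, where \<open>1 - a * Q ^ j\<close> vanishes modulo \<open>p\<close>
  but not identically.\<close>

lemma aQ_neq_1: "a * Q ^ j \<noteq> 1"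
proof -
  have "r + int d * int j \<noteq> 0"
  proof
    assume "r + int d * int j = 0"
    then have "int d dvd r"
      by (metis add.commute dvd_add_right_iff dvd_0_right dvd_triv_left)
    then have "int d dvd 1"
      using coprime_d_r by (metis coprime_absorb_left)
    then show False using d_ge by simp
  qed
  then show ?thesis
    unfolding aQ by (intro q_powi_neq_1) simp
qed

lemma a_mem: "a \<in> S" and Q_mem: "Q ^ j \<in> S"
  by (simp_all add: a_def Q_power powi_mem)

lemma unit_minus: "\<not> int n dvd j - i \<Longrightarrow> inverse (q powi i - q powi j) \<in> S"
proof -
  assume *: "\<not> int n dvd j - i"
  have "q powi i - q powi j = q powi i * (1 - q powi (j - i))"
    using powi_add[of i "j - i"] by (simp add: algebra_simps)
  then have "inverse (q powi i - q powi j) = q powi (- i) * inverse (1 - q powi (j - i))"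
    by (simp add: power_int_minus)
  then show ?thesis
    using unit[OF *] by (simp add: mult_mem powi_mem)
qed

lemma not_dvd: "0 < j \<Longrightarrow> j < n \<Longrightarrow> \<not> int n dvd 2 * int d * int j"
  unfolding dvd_2d by (auto dest: zdvd_imp_le)

lemma unit_x_minus_Q:
  assumes "j + 1 < n"
  shows "inverse (q powi (int n * c) - Q ^ (j + 1)) \<in> S"
proof -
  have "\<not> int n dvd 2 * int d * int (j + 1) - int n * c"
    using not_dvd[of "j + 1"] assms by (simp add: dvd_diff_left_iff)
  then show ?thesis
    unfolding Q_power by (rule unit_minus)
qed

lemma unit_1_minus_Q: "j + 1 < n \<Longrightarrow> inverse (1 - Q ^ (j + 1)) \<in> S"
  using unit_x_minus_Q[of j 0] by simp

lemma aQ_exponent: "2 * r + 2 * int d * int j = 2 * int n * (int d - 1) - 2 * int d * (int N - int j)"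
  using r_eq by (simp add: algebra_simps)

lemma unit_1_minus_aQ:
  assumes "j < N"
  shows "inverse (1 - a * Q ^ j) \<in> S"
proof -
  have "\<not> int n dvd 2 * r + 2 * int d * int j"
    unfolding aQ_exponent using not_dvd[of "N - j"] assms N_lt
    by (subst dvd_diff_right_iff) (simp_all add: of_nat_diff)
  then show ?thesis
    unfolding aQ by (rule unit)
qed

lemma Q_reflect: "j < N \<Longrightarrow> a * Q ^ (N - 1 - j) * Q ^ (j + 1) = a * Q ^ N"
  by (simp add: mult.assoc flip: power_add power_Suc)

section \<open>Integrality, vanishing and antisymmetry of the summands\<close>

lemma T_mem:
  assumes "k \<le> N"
  shows "T k \<in> S"
proof -
  have "(\<Prod>j<k. 1 - a * Q ^ j) / (\<Prod>j<k. 1 - Q ^ (j + 1)) = (\<Prod>j<k. (1 - a * Q ^ j) / (1 - Q ^ (j + 1)))"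
    by (simp add: prod_dividef)
  also have "\<dots> \<in> S"
    using assms N_lt
    by (intro prod_mem div_mem unit_1_minus_Q diff_mem one_mem mult_mem a_mem Q_mem) auto
  finally show ?thesis
    unfolding T_def Z_def
    by (intro mult_mem power_mem diff_mem one_mem a_mem Q_mem powi_mem)
qed

text \<open>The numerator contains the multiple \<open>1 - a * Q ^ N\<close> of \<open>p\<close>,
  while \<open>k < n\<close> keeps the denominators units. Two of the \<open>d\<close> copies of the
  quotient supply \<open>p ^ 2\<close>.\<close>

lemma T_high:
  assumes "N < k" "k < n"
  shows "cg 2 (T k) 0"
proof -
  let ?A = "\<Prod>j<k. 1 - a * Q ^ j" and ?B = "\<Prod>j<k. 1 - Q ^ (j + 1)"
  have "?A / ?B = (1 - a * Q ^ N) * ((\<Prod>j\<in>{..<k} - {N}. 1 - a * Q ^ j) * (\<Prod>j<k. 1 / (1 - Q ^ (j + 1))))"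
    using assms by (subst prod.remove[of "{..<k}" N]) (auto simp: prod_dividef)
  moreover have "cg 1 (1 - a * Q ^ N) 0"
    unfolding aQ_N by (rule cg_1_powi) simp
  moreover have c: "(\<Prod>j\<in>{..<k} - {N}. 1 - a * Q ^ j) * (\<Prod>j<k. 1 / (1 - Q ^ (j + 1))) \<in> S" (is "?C \<in> S")
    using assms
    by (intro mult_mem prod_mem div_mem unit_1_minus_Q diff_mem one_mem mult_mem a_mem Q_mem) auto
  ultimately have AB: "cg 1 (?A / ?B) 0"
    using cg_mult_right[of 1 "1 - a * Q ^ N" 0 ?C] by simp
  have AB_mem: "?A / ?B \<in> S"
    unfolding \<open>?A / ?B = _\<close> by (intro mult_mem c diff_mem one_mem a_mem Q_mem)
  have "(?A / ?B) ^ d = (?A / ?B * (?A / ?B)) * (?A / ?B) ^ (d - 2)"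
    by (rule power_d)
  then have T: "T k = (?A / ?B * (?A / ?B)) * ((?A / ?B) ^ (d - 2) * (1 - a * Q ^ (2 * k)) * Z ^ k)"
    by (simp add: T_def)
  have "cg 2 (?A / ?B * (?A / ?B)) 0"
    using cg_mult_0[OF AB AB] unfolding one_add_one .
  from cg_mult_right[OF this, of "(?A / ?B) ^ (d - 2) * (1 - a * Q ^ (2 * k)) * Z ^ k"] show ?thesis
    unfolding T Z_def
    using AB_mem by (simp add: mult_mem power_mem diff_mem one_mem a_mem Q_mem powi_mem)
qed

text \<open>The summand is split as \<open>L k * X k ^ d * (- 1) ^ k\<close>. Since
  \<open>a * Q ^ N\<close> is congruent to \<open>1\<close>,
  \<open>L k = Q powi (- k) - a * Q ^ k\<close> changes sign modulo \<open>p\<close> under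
  \<open>k \<mapsto> N - k\<close>, and \<open>X\<close> is symmetric by \<open>cg_reflect\<close>.
  The sign is symmetric because \<open>N\<close> is even.\<close>

lemma T_antisym:
  assumes "k \<le> N"
  shows "cg 1 (T k + T (N - k)) 0"
proof -
  define w where "w = int n * (int d - 1)"
  define g where "g = q powi (int d - r)"
  \<comment> \<open>Modulo \<open>p\<close>, \<open>1 - a * Q ^ (N - 1 - j)\<close> is a monomial
    times \<open>1 - Q ^ (j + 1)\<close>. The sign and the powers of \<open>q\<close> in
    \<open>u\<close> and \<open>v\<close> absorb this monomial, while contributing only the constant
    \<open>- g\<close> to \<open>u j * v j\<close>.\<close>
  define u where "u j = (1 - a * Q ^ j) * q powi (- int d * int j)" for j
  define v where "v j = - (q powi (int d - r + int d * int j)) / (1 - Q ^ (j + 1))" for j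
  define X where "X k = (\<Prod>j<k. u j * v j)" for k
  define L where "L k = q powi (- 2 * int d * int k) - q powi (2 * r + 2 * int d * int k)" for k
  have w0: "cg 1 (1 - q powi w) 0" "cg 1 (1 - q powi (- w)) 0" "cg 1 (1 - q powi (2 * w)) 0" "cg 1 (1 - q powi (- 2 * w)) 0"
    by (rule cg_1_powi; simp add: w_def)+
  have u: "u j \<in> S" for j
    unfolding u_def by (intro mult_mem powi_mem diff_mem one_mem a_mem Q_mem)
  have v: "v j \<in> S" if "j < N" for j
    unfolding v_def using that N_lt by (intro div_mem minus_mem powi_mem unit_1_minus_Q) simp
  have uv: "cg 1 (u (N - 1 - j) * v j) 1" if "j < N" for j
  proof -
    have Nj: "int (N - 1 - j) = int N - 1 - int j" using that by simp
    let ?A = "a * Q ^ (N - 1 - j)" and ?P = "Q ^ (j + 1)"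
    have e: "q powi (- int d * int (N - 1 - j)) * q powi (int d - r + int d * int j) = q powi (- w) * ?P"
      unfolding Q_power powi_add[symmetric] Nj w_def r_eq[symmetric]
      by (rule arg_cong[of _ _ "power_int q"]) (simp add: algebra_simps)
    have AP: "?A * ?P = q powi w * q powi w"
      unfolding Q_reflect[OF that] aQ_N powi_add[symmetric] w_def by (simp add: algebra_simps)
    have ww: "q powi (- w) * q powi w = 1"
      using q_neq_0 by (simp add: power_int_minus)
    have lin: "(1 - x) * (y * z) = y * z - y * (x * z)"
      and frac: "z \<noteq> 1 \<Longrightarrow> - (x * z - y) / (1 - z) - 1 = ((1 - x) * z + - (1 - y)) * (1 / (1 - z))" for x y z :: 'a
      by (simp_all add: field_simps)
    have "(1 - ?A) * (q powi (- w) * ?P) = q powi (- w) * ?P - q powi (- w) * (?A * ?P)"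
      by (rule lin)
    also have "\<dots> = q powi (- w) * ?P - q powi w"
      unfolding AP mult.assoc[symmetric] ww by simp
    finally have "(1 - ?A) * (q powi (- w) * ?P) = \<dots>" .
    moreover have "u (N - 1 - j) * v j = - ((1 - ?A) * (q powi (- w) * ?P)) / (1 - ?P)"
      unfolding u_def v_def e[symmetric] by simp
    ultimately have "u (N - 1 - j) * v j = - (q powi (- w) * ?P - q powi w) / (1 - ?P)"
      by (simp only:)
    then have "u (N - 1 - j) * v j - 1 = ((1 - q powi (- w)) * ?P + - (1 - q powi w)) * (1 / (1 - ?P))"
      by (simp only:) (rule frac, rule Q_power_neq_1, simp)
    moreover have "cg 1 \<dots> 0"
      by (intro cg_0_mult_right cg_0_add cg_0_minus w0 Q_mem div_mem one_mem unit_1_minus_Q) (use that N_lt in linarith)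
    ultimately show ?thesis
      using cg_iff_diff by metis
  qed
  have X_mem: "X l \<in> S" if "l \<le> N" for l
    using that unfolding X_def by (intro prod_mem mult_mem u v) auto
  have X: "X l = (\<Prod>j<l. 1 - a * Q ^ j) / (\<Prod>j<l. 1 - Q ^ (j + 1)) * (- g) ^ l" for l
  proof -
    have uv: "u j * v j = (1 - a * Q ^ j) / (1 - Q ^ (j + 1)) * (- g)" for j
    proof -
      have "q powi (- int d * int j) * q powi (int d - r + int d * int j) = g"
        unfolding powi_add[symmetric] g_def by simp
      then show ?thesis unfolding u_def v_def by (simp add: mult.assoc del: power_Suc)
    qed
    show ?thesis
      unfolding X_def uv prod.distrib prod_dividef by simp
  qed
  have T: "T l = L l * X l ^ d * (- 1) ^ l" for l
  proof -
    \<comment> \<open>Oddness of \<open>d\<close> cancels the two signs, and the exponent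
      \<open>d * (d - r) - 2 * d\<close> is that of \<open>Z\<close>.\<close>
    have "(- g) ^ d * q powi (- 2 * int d) * (- 1) = Z"
    proof -
      have "g ^ d * q powi (- 2 * int d) = Z"
        unfolding g_def Z_def power_int_power' powi_add[symmetric]
        by (rule arg_cong[of _ _ "power_int q"]) (simp add: algebra_simps)
      then show ?thesis using d_odd by simp
    qed
    then have "Z ^ l = ((- g) ^ d * q powi (- 2 * int d) * (- 1)) ^ l"
      by simp
    also have "\<dots> = ((- g) ^ l) ^ d * q powi (- 2 * int d * int l) * (- 1) ^ l"
      by (simp only: power_mult_distrib power_int_power' power_mult[symmetric] mult.commute[of d])
    finally have Zl: "Z ^ l = \<dots>" .
    have Ll: "(1 - a * Q ^ (2 * l)) * q powi (- 2 * int d * int l) = L l"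
      unfolding L_def aQ left_diff_distrib powi_add[symmetric] by (simp add: algebra_simps)
    show ?thesis
      unfolding T_def X power_mult_distrib Zl Ll[symmetric] by (simp only: ac_simps)
  qed
  have "L k + L (N - k) = q powi (- 2 * int d * int k) * (1 - q powi (2 * w)) + - (q powi (2 * r + 2 * int d * int k) * (1 - q powi (- 2 * w)))"
  proof -
    have Nk: "int (N - k) = int N - int k" using assms by simp
    have 1: "q powi (- 2 * int d * int (N - k)) = q powi (2 * r + 2 * int d * int k) * q powi (- 2 * w)"
      unfolding Nk powi_add[symmetric] w_def r_eq[symmetric]
      by (rule arg_cong[of _ _ "power_int q"]) (simp add: algebra_simps)
    have 2: "q powi (2 * r + 2 * int d * int (N - k)) = q powi (- 2 * int d * int k) * q powi (2 * w)"
      unfolding Nk powi_add[symmetric] w_def r_eq[symmetric]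
      by (rule arg_cong[of _ _ "power_int q"]) (simp add: algebra_simps)
    have "(x - y) + (y * z - x * z') = x * (1 - z') + - (y * (1 - z))" for x y z z' :: 'a
      by (simp add: algebra_simps)
    then show ?thesis
      unfolding L_def 1 2 .
  qed
  then have LL: "cg 1 (L k + L (N - k)) 0"
    by (simp only:) (intro cg_0_mult_left cg_0_add cg_0_minus w0 powi_mem)
  have "cg 1 (X k) (X (N - k))"
    unfolding X_def using assms u v uv by (rule cg_reflect[of k N u v 1])
  then have "cg 1 (X k ^ d) (X (N - k) ^ d)"
    using assms by (intro cg_power X_mem) auto
  moreover have "L (N - k) * (- 1) ^ k \<in> S"
    unfolding L_def by (intro mult_mem diff_mem powi_mem power_mem minus_mem one_mem)
  ultimately have XX: "cg 1 (X (N - k) ^ d * (L (N - k) * (- 1) ^ k)) (X k ^ d * (L (N - k) * (- 1) ^ k))"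
    by (rule cg_mult_right[OF cg_sym])
  have "even (N - k) = even k"
    using N_even assms by simp
  then have sign: "(- 1 :: 'a) ^ (N - k) = (- 1) ^ k"
    by (simp add: minus_one_power_iff)
  have "T (N - k) = X (N - k) ^ d * (L (N - k) * (- 1) ^ k)"
    unfolding T[of "N - k"] sign by (simp only: ac_simps)
  then have "cg 1 (T k + T (N - k)) (T k + X k ^ d * (L (N - k) * (- 1) ^ k))"
    using cg_add[OF cg_refl XX] by (simp only:)
  also have "T k + X k ^ d * (L (N - k) * (- 1) ^ k) = (L k + L (N - k)) * (X k ^ d * (- 1) ^ k)"
    unfolding T[of k] by (simp only: distrib_right) (simp only: ac_simps)
  also have "cg 1 \<dots> 0"
    using assms by (intro cg_0_mult_right LL mult_mem power_mem X_mem minus_mem one_mem)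
  finally show ?thesis .
qed

section \<open>The deformation factors modulo \<open>p\<close> and \<open>p ^ 2\<close>\<close>

lemma x_minus_Q_neq_0:
  assumes "j + 1 < n"
  shows "q powi (int n * c) - Q ^ (j + 1) \<noteq> 0"
proof
  assume "q powi (int n * c) - Q ^ (j + 1) = 0"
  then have "q powi (int n * c - 2 * int d * int (j + 1)) = 1"
    unfolding Q_power using q_neq_0 by (simp add: power_int_diff)
  then have "int n * c - 2 * int d * int (j + 1) = 0"
    using q_powi_neq_1 by blast
  then have "int n * c = 2 * int d * int (j + 1)"
    by simp
  then have "int n dvd 2 * int d * int (j + 1)"
    by (metis dvd_triv_left)
  then show False
    using not_dvd[of "j + 1"] assms by simp
qed

lemma cg_0_1_minus_x: "cg 1 (1 - q powi (int n * c)) 0"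
  by (rule cg_1_powi) simp

lemma \<rho>_num_mem: "j < N \<Longrightarrow> (1 - a * q powi (int n * c) * Q ^ j) / (1 - a * Q ^ j) \<in> S"
  by (intro div_mem diff_mem one_mem mult_mem a_mem powi_mem Q_mem unit_1_minus_aQ)

lemma \<rho>_den_mem: "j < N \<Longrightarrow> (1 - Q ^ (j + 1)) / (q powi (int n * c) - Q ^ (j + 1)) \<in> S"
  using N_lt by (intro div_mem diff_mem one_mem Q_mem unit_x_minus_Q) simp

lemma \<rho>_mem: "k \<le> N \<Longrightarrow> \<rho> (q powi (int n * c)) k \<in> S"
  unfolding \<rho>_def by (intro prod_mem mult_mem \<rho>_num_mem \<rho>_den_mem) auto

text \<open>The symmetry holds modulo \<open>p ^ 2\<close> because the error of each reflected pair
  of factors contains both \<open>1 - x\<close> and \<open>1 - a * Q ^ N\<close>, and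
  \<open>p\<close> divides each of them.\<close>

lemma \<rho>_reflect:
  assumes "k \<le> N"
  shows "cg 2 (\<rho> (q powi (int n * c)) k) (\<rho> (q powi (int n * c)) (N - k))"
  unfolding \<rho>_def
proof (rule cg_reflect[OF assms \<rho>_num_mem \<rho>_den_mem])
  let ?x = "q powi (int n * c)"
  fix j assume j: "j < N"
  let ?A = "a * Q ^ (N - 1 - j)" and ?P = "Q ^ (j + 1)"
  have frac: "(1 - x * A) / (1 - A) * ((1 - P) / (x - P)) - 1
      = (1 - x) * (1 - A * P) * (1 / (1 - A) * (1 / (x - P)))"
    if "1 - A \<noteq> 0" "x - P \<noteq> 0" for x A P :: 'a
  proof -
    have "y / u * (z / v) - 1 = (y * z - u * v) * (1 / u * (1 / v))" if "u \<noteq> 0" "v \<noteq> 0" for y z u v :: 'a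
      using that by (simp add: field_simps)
    then have "(1 - x * A) / (1 - A) * ((1 - P) / (x - P)) - 1
        = ((1 - x * A) * (1 - P) - (1 - A) * (x - P)) * (1 / (1 - A) * (1 / (x - P)))"
      using that by blast
    also have "(1 - x * A) * (1 - P) - (1 - A) * (x - P) = (1 - x) * (1 - A * P)"
      by (simp add: algebra_simps)
    finally show ?thesis .
  qed
  have "1 - ?A \<noteq> 0" using aQ_neq_1[of "N - 1 - j"] by simp
  moreover have "?x - ?P \<noteq> 0" using x_minus_Q_neq_0 j N_lt by simp
  ultimately have "(1 - ?x * ?A) / (1 - ?A) * ((1 - ?P) / (?x - ?P)) - 1
      = (1 - ?x) * (1 - a * Q ^ N) * (1 / (1 - ?A) * (1 / (?x - ?P)))"
    unfolding Q_reflect[OF j, symmetric] by (rule frac)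
  moreover have "cg 2 ((1 - ?x) * (1 - a * Q ^ N)) 0"
  proof -
    have "cg 1 (1 - a * Q ^ N) 0"
      unfolding aQ_N by (rule cg_1_powi) simp
    from cg_mult_0[OF cg_0_1_minus_x this] show ?thesis
      unfolding one_add_one .
  qed
  moreover have "1 / (1 - ?A) * (1 / (?x - ?P)) \<in> S"
    using j N_lt by (intro mult_mem div_mem one_mem unit_1_minus_aQ unit_x_minus_Q) auto
  ultimately have "cg 2 ((1 - ?x * ?A) / (1 - ?A) * ((1 - ?P) / (?x - ?P)) - 1) 0"
    by (simp only: cg_0_mult_right)
  then show "cg 2 ((1 - a * ?x * Q ^ (N - 1 - j)) / (1 - ?A) * ((1 - ?P) / (?x - ?P))) 1"
    using cg_iff_diff by (simp only: mult.assoc mult.left_commute[of ?x])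
qed

lemma \<rho>_cg_1:
  assumes "k \<le> N"
  shows "cg 1 (\<rho> (q powi (int n * c)) k) 1"
proof -
  let ?x = "q powi (int n * c)"
  have "cg 1 ((1 - a * ?x * Q ^ j) / (1 - a * Q ^ j) * ((1 - Q ^ (j + 1)) / (?x - Q ^ (j + 1)))) (1 * 1)"
    if j: "j < N" for j
  proof (rule cg_mult)
    have "(1 - a * ?x * Q ^ j) / (1 - a * Q ^ j) - 1 = (1 - ?x) * (a * Q ^ j / (1 - a * Q ^ j))"
      using aQ_neq_1[of j] by (simp add: field_simps)
    moreover have "cg 1 \<dots> 0"
      using j by (intro cg_0_mult_right cg_0_1_minus_x div_mem mult_mem a_mem Q_mem unit_1_minus_aQ)
    ultimately show "cg 1 ((1 - a * ?x * Q ^ j) / (1 - a * Q ^ j)) 1"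
      using cg_iff_diff by metis
    have "(1 - P) / (x - P) - 1 = (1 - x) * (1 / (x - P))" if "x - P \<noteq> 0" for x P :: 'a
      using that by (simp add: field_simps)
    then have "(1 - Q ^ (j + 1)) / (?x - Q ^ (j + 1)) - 1 = (1 - ?x) * (1 / (?x - Q ^ (j + 1)))"
      using x_minus_Q_neq_0 j N_lt by simp
    moreover have "cg 1 \<dots> 0"
      using j N_lt by (intro cg_0_mult_right cg_0_1_minus_x div_mem one_mem unit_x_minus_Q) simp
    ultimately show "cg 1 ((1 - Q ^ (j + 1)) / (?x - Q ^ (j + 1))) 1"
      using cg_iff_diff by metis
  qed (rule \<rho>_den_mem[OF j], rule one_mem)
  then have "cg 1 (\<rho> ?x k) (\<Prod>j<k. 1 * 1)"
    unfolding \<rho>_def using assms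
    by (intro cg_prod mult_mem \<rho>_num_mem \<rho>_den_mem one_mem) auto
  then show ?thesis by simp
qed

lemma R_reflect: "k \<le> N \<Longrightarrow> cg 2 (R k) (R (N - k))"
  unfolding R_def x1_def x2_def by (intro cg_mult cg_power power_mem \<rho>_mem \<rho>_reflect) auto

lemma R_cg_1:
  assumes "k \<le> N"
  shows "cg 1 (R k) 1"
proof -
  have "cg 1 (R k) (1 * 1 ^ (d - 2))"
    unfolding R_def x1_def x2_def using assms
    by (intro cg_mult cg_power power_mem one_mem \<rho>_mem \<rho>_cg_1)
  then show ?thesis by simp
qed

section \<open>Vanishing of the deformed sum\<close>

lemma x1_aQ: "x1 * (a * Q ^ (N + j)) = Q ^ j"
proof -
  have "x1 * (a * Q ^ N) = 1"
    unfolding aQ_N x1_def powi_add[symmetric] by (simp add: algebra_simps)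
  then show ?thesis
    by (simp add: power_add flip: mult.assoc)
qed

text \<open>Only a degree bound matters here: \<open>m * (d - 2) < N\<close>, which is where \<open>r \<le> n\<close> enters.\<close>

lemma sum_TR_eq_0: "(\<Sum>k\<le>N. T k * R k) = 0"
proof -
  \<comment> \<open>The partner \<open>Q / x2\<close> of the parameter
    \<open>a * x2\<close>.\<close>
  define b where "b = q powi (2 * int d - int n)"
  have b_neq: "b * Q ^ j \<noteq> 1" for j
  proof -
    \<comment> \<open>Since \<open>n\<close> is odd, so is the exponent of \<open>b * Q ^ j\<close>,
      which therefore cannot be zero.\<close>
    have "odd (2 * int d - int n + 2 * int d * int j)"
      using n_odd by simp
    then have "2 * int d - int n + 2 * int d * int j \<noteq> 0"
      by (metis even_zero)
    then show ?thesis
      unfolding b_def Q_power powi_add[symmetric] by (rule q_powi_neq_1)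
  qed
  have b_x2: "x2 * b = Q"
    unfolding x2_def b_def Q_def powi_add[symmetric] by simp
  have ax2: "a * x2 = b * Q ^ (2 * m)"
    unfolding x2_def b_def a_def Q_power powi_add[symmetric]
    by (rule arg_cong[of _ _ "power_int q"]) (simp add: n_eq algebra_simps)
  have "b \<noteq> 0" "x1 \<noteq> 0" "x2 \<noteq> 0"
    by (simp_all add: b_def x1_def x2_def q_neq_0)
  have "b ^ 2 * Q ^ (2 * m) = b * (a * x2)"
    unfolding ax2 by (simp add: power2_eq_square)
  also have "\<dots> = a * (x2 * b)"
    by simp
  finally have bal: "b ^ 2 * Q ^ (2 * m) = a * Q"
    unfolding b_x2 .
  obtain f where f: "degree f = m"
    "\<And>k. (\<Prod>j<k. 1 - b * Q ^ (2 * m + j)) / (\<Prod>j<k. 1 - b * Q ^ j) = Q ^ (m * k) * poly f (1 / Q ^ k + a * Q ^ k)"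
    using well_poised_factor_poly[OF Q_neq_0 \<open>b \<noteq> 0\<close> bal b_neq] by blast
  \<comment> \<open>From \<open>n + r = d * (2 * m + 1)\<close> and \<open>r \<le> n\<close> one
    gets \<open>2 * n \<ge> d * (2 * m + 1)\<close>; then \<open>2 * (2 * m + 1)\<close> is
    subtracted.\<close>
  have "2 * int N \<ge> (int d - 2) * (2 * int m + 1)"
    using n_eq N_eq n_ge by (simp add: algebra_simps)
  moreover have "(int d - 2) * (2 * int m + 1) > 2 * (int m * (int d - 2))"
    using d_ge by (simp add: algebra_simps)
  ultimately have "int m * (int d - 2) < int N" by linarith
  then have "int (m * (d - 2)) < int N"
    using d_ge by (simp add: of_nat_diff)
  then have "m * (d - 2) < N"
    by (simp only: of_nat_less_iff)
  then have deg: "degree (f ^ (d - 2)) < N"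
    using degree_power_le[of f "d - 2"] f(1) by (simp add: mult.commute)
  \<comment> \<open>The balance of the factors raised to the power \<open>k\<close>: the deformed
    argument \<open>Z / (x1 * x2 ^ (d - 2))\<close>, times the powers of \<open>Q\<close> from the
    \<open>d - 2\<close> polynomial factors, must be the \<open>Q ^ N\<close> of
    \<open>well_poised_sum_eq_0\<close>.\<close>
  have step: "x2 ^ (d - 2) * x1 * Q ^ N = Q ^ (m * (d - 2)) * Z"
  proof -
    have "int n * int (d - 2) + int n * (2 - 2 * int d) + 2 * int d * int N
        = 2 * int d * int (m * (d - 2)) + int d * (int d - r - 2)"
    proof -
      have d2: "int (d - 2) = int d - 2" using d_ge by simp
      show ?thesis
        unfolding of_nat_mult d2 N_eq n_eq by (simp add: algebra_simps)
    qed
    then show ?thesis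
      unfolding x2_def x1_def Q_power Z_def power_int_power' powi_add[symmetric] by simp
  qed
  have \<rho>_eq: "\<rho> x k = (\<Prod>j<k. 1 - a * x * Q ^ j) / (\<Prod>j<k. 1 - a * Q ^ j)
      * ((\<Prod>j<k. 1 - Q ^ (j + 1)) / (\<Prod>j<k. x - Q ^ (j + 1)))" for x k
    unfolding \<rho>_def by (simp only: prod.distrib prod_dividef)
  have "T k * R k = (1 - a * Q ^ (2 * k)) * ((\<Prod>j<k. 1 - a * Q ^ j) / (\<Prod>j<k. 1 - Q ^ (j + 1)))
      * ((\<Prod>j<k. 1 - Q ^ j / Q ^ N) / (\<Prod>j<k. 1 - a * Q ^ (N + 1 + j)))
      * Q ^ (N * k) * poly (f ^ (d - 2)) (1 / Q ^ k + a * Q ^ k)" for k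
  proof -
    let ?A = "\<Prod>j<k. 1 - a * Q ^ j" and ?B = "\<Prod>j<k. 1 - Q ^ (j + 1)"
      and ?C = "\<Prod>j<k. 1 - Q ^ j / Q ^ N" and ?D = "\<Prod>j<k. 1 - a * Q ^ (N + 1 + j)"
      and ?p = "poly f (1 / Q ^ k + a * Q ^ k)"
    have A: "?A \<noteq> 0" using aQ_neq_1 by auto
    have B: "?B \<noteq> 0" using Q_power_neq_1 by (auto simp del: power_Suc)
    have "a * x1 * Q ^ j = Q ^ j / Q ^ N" for j
      using x1_aQ[of 0] by (simp add: field_simps)
    moreover have "x1 - Q ^ (j + 1) = x1 * (1 - a * Q ^ (N + 1 + j))" for j
      using x1_aQ[of "j + 1"] by (simp add: algebra_simps)
    ultimately have \<rho>1: "\<rho> x1 k = ?C / ?A * (?B / (x1 ^ k * ?D))"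
      unfolding \<rho>_eq by (simp only: prod.distrib prod_constant card_lessThan)
    have "a * x2 * Q ^ j = b * Q ^ (2 * m + j)" for j
      unfolding ax2 by (simp add: power_add)
    moreover have "x2 - Q ^ (j + 1) = x2 * (1 - b * Q ^ j)" for j
      using b_x2 by (simp add: algebra_simps)
    ultimately have "\<rho> x2 k = (\<Prod>j<k. 1 - b * Q ^ (2 * m + j)) / ?A * (?B / (x2 ^ k * (\<Prod>j<k. 1 - b * Q ^ j)))"
      unfolding \<rho>_eq by (simp only: prod.distrib prod_constant card_lessThan)
    also have "\<dots> = ((\<Prod>j<k. 1 - b * Q ^ (2 * m + j)) / (\<Prod>j<k. 1 - b * Q ^ j)) * (?B / ?A) / x2 ^ k"
      by simp
    finally have \<rho>2: "\<rho> x2 k = Q ^ (m * k) * ?p * (?B / ?A) / x2 ^ k"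
      unfolding f(2) .
    have R: "R k = ?C / ?D * (?B / ?A) * (?B / ?A) ^ (d - 2) * ?p ^ (d - 2) * (Q ^ (m * k) / x2 ^ k) ^ (d - 2) / x1 ^ k"
      unfolding R_def \<rho>1 \<rho>2 by (simp add: power_mult_distrib power_divide ac_simps del: power_Suc)
    have "(Q ^ (m * k) / x2 ^ k) ^ (d - 2) / x1 ^ k * Z ^ k = (Q ^ (m * (d - 2)) * Z / (x2 ^ (d - 2) * x1)) ^ k"
      by (simp add: power_divide power_mult_distrib ac_simps flip: power_mult)
    also have "\<dots> = Q ^ (N * k)"
      using \<open>x1 \<noteq> 0\<close> \<open>x2 \<noteq> 0\<close> unfolding step[symmetric] by (simp add: power_mult)
    finally have pow: "(Q ^ (m * k) / x2 ^ k) ^ (d - 2) / x1 ^ k * Z ^ k = Q ^ (N * k)" .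
    have cancel: "x * x * y * (z * w) = x" if "y * w = 1" "x * z = 1" for x y z w :: 'a
    proof -
      have "x * x * y * (z * w) = x * ((x * z) * (y * w))" by (simp only: ac_simps)
      then show ?thesis using that by simp
    qed
    have "(?A / ?B) ^ (d - 2) * (?B / ?A) ^ (d - 2) = 1"
      using A B unfolding power_mult_distrib[symmetric] by simp
    moreover have "(?A / ?B) * (?B / ?A) = 1"
      using A B by simp
    \<comment> \<open>\<open>R k\<close> contributes \<open>d - 1\<close> inverse copies of
      \<open>?A / ?B\<close>, leaving one of the \<open>d\<close> copies in
      \<open>T k\<close>.\<close>
    ultimately have AB: "(?A / ?B) ^ d * ((?B / ?A) * (?B / ?A) ^ (d - 2)) = ?A / ?B"
      unfolding power_d by (rule cancel)
    have "T k * R k = (1 - a * Q ^ (2 * k)) * ((?A / ?B) ^ d * ((?B / ?A) * (?B / ?A) ^ (d - 2))) * (?C / ?D)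
        * ((Q ^ (m * k) / x2 ^ k) ^ (d - 2) / x1 ^ k * Z ^ k) * ?p ^ (d - 2)"
      unfolding T_def R times_divide_eq_right times_divide_eq_left divide_divide_eq_left by (simp only: ac_simps)
    then show ?thesis
      unfolding AB pow poly_power .
  qed
  then show ?thesis
    using well_poised_sum_eq_0[OF Q_neq_0 Q_power_neq_1 aQ_neq_1 deg] by simp
qed

text \<open>Adding the sum to its reversal pairs \<open>k\<close> with \<open>N - k\<close> without
  singling out the midpoint \<open>k = N / 2\<close>, at the cost of a factor \<open>2\<close>,
  which is a unit.\<close>

lemma sum_T_cg_0: "cg 2 (\<Sum>k<n. T k) 0"
proof -
  let ?g = "\<lambda>k. T k * (1 - R k)"
  have pair: "cg 2 (?g k + ?g (N - k)) 0" if "k \<le> N" for k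
  proof -
    \<comment> \<open>In the first product each factor supplies one \<open>p\<close>; in the second,
      the difference of the \<open>R\<close> values alone supplies \<open>p ^ 2\<close>.\<close>
    have "?g k + ?g (N - k) = (T k + T (N - k)) * (1 - R k) + T (N - k) * (R k - R (N - k))"
      by (simp add: algebra_simps)
    moreover have "cg 2 ((T k + T (N - k)) * (1 - R k)) 0"
      using cg_mult_0[OF T_antisym[OF that] iffD1[OF cg_iff_diff cg_sym[OF R_cg_1[OF that]]]]
      unfolding one_add_one .
    moreover have "cg 2 (T (N - k) * (R k - R (N - k))) 0"
      by (intro cg_0_mult_left iffD1[OF cg_iff_diff] R_reflect[OF that] T_mem) simp
    ultimately show ?thesis
      by (simp only: cg_0_add)
  qed
  have "(\<Sum>k\<le>N. T k) = (\<Sum>k\<le>N. ?g k)"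
    using sum_TR_eq_0 by (simp add: right_diff_distrib sum_subtractf)
  moreover have "(\<Sum>k\<le>N. ?g k) = (\<Sum>k\<le>N. ?g (N - k))"
    by (rule sum.nat_diff_reindex[of _ "Suc N", unfolded lessThan_Suc_atMost, simplified, symmetric])
  ultimately have "2 * (\<Sum>k\<le>N. T k) = (\<Sum>k\<le>N. ?g k + ?g (N - k))"
    by (simp add: sum.distrib)
  moreover have "cg 2 \<dots> (\<Sum>k\<le>N. 0)"
    by (intro cg_sum pair) simp
  ultimately have "cg 2 (2 * (\<Sum>k\<le>N. T k)) 0"
    by simp
  then have "cg 2 (inverse 2 * (2 * (\<Sum>k\<le>N. T k))) 0"
    by (rule cg_0_mult_left[OF _ inverse_2_mem])
  then have "cg 2 (\<Sum>k\<le>N. T k) 0"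
    using two_neq_0 by (simp flip: mult.assoc)
  moreover have "cg 2 (\<Sum>k\<in>{N<..<n}. T k) (\<Sum>k\<in>{N<..<n}. 0)"
    by (intro cg_sum T_high) auto
  moreover have "(\<Sum>k<n. T k) = (\<Sum>k\<le>N. T k) + (\<Sum>k\<in>{N<..<n}. T k)"
    using N_lt by (subst sum.union_disjoint[symmetric]) (auto intro!: sum.cong)
  ultimately show ?thesis
    using cg_0_add by simp
qed

end

subsection \<open>Localisation at a cyclotomic polynomial\<close>

lemma to_fract_power: "to_fract (u ^ k) = to_fract u ^ k"
  by (induction k) simp_all

lemma coprime_linear_polyI:
  fixes c :: "'a::{field_gcd}"
  shows "poly u c \<noteq> 0 \<Longrightarrow> coprime u [:- c, 1:]"
  by (metis coprime_commute one_neq_zero poly_eq_0_iff_dvd prime_elem_imp_coprime prime_elem_linear_field_poly)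

lemma prod_linear_dvd:
  fixes u :: "'a::field poly"
  assumes "finite C" "\<And>c. c \<in> C \<Longrightarrow> poly u c = 0"
  shows "(\<Prod>c\<in>C. [:- c, 1:]) dvd u"
  using assms
proof (induction C arbitrary: u rule: finite_induct)
  case (insert c C)
  then obtain v where v: "u = [:- c, 1:] * v"
    using poly_eq_0_iff_dvd by (metis dvdE insertI1)
  have "poly v x = 0" if "x \<in> C" for x
    using insert.prems[of x] insert.hyps that by (auto simp: v)
  then have "(\<Prod>c\<in>C. [:- c, 1:]) dvd v"
    by (rule insert.IH)
  then show ?case
    unfolding v prod.insert[OF insert.hyps(1,2)] by (intro mult_dvd_mono dvd_refl)
qed simp

definition zeta :: "nat \<Rightarrow> nat \<Rightarrow> complex" where
  "zeta n k = exp (2 * of_real pi * \<i> * of_nat k / of_nat n)"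

lemma cyclotomic_eq: "cyclotomic n = (\<Prod>k\<in>{k. k < n \<and> coprime k n}. [:- zeta n k, 1:])"
  by (simp add: cyclotomic_def zeta_def)

lemma zeta_power_eq_1_iff:
  assumes "n > 0" "coprime k n"
  shows "zeta n k ^ j = 1 \<longleftrightarrow> n dvd j"
proof -
  have "zeta n k ^ j = exp (2 * of_real pi * \<i> * of_nat (k * j) / of_nat n)"
    by (simp add: zeta_def ac_simps flip: exp_of_nat_mult)
  then show ?thesis
    using complex_root_unity_eq_1[of n "k * j"] assms
    by (simp add: coprime_commute coprime_dvd_mult_right_iff)
qed

lemma inj_on_zeta: "n > 0 \<Longrightarrow> inj_on (zeta n) {..<n}"
  by (auto simp: inj_on_def zeta_def complex_root_unity_eq)

lemma coprime_cyclotomic: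
  assumes "\<And>k. k < n \<Longrightarrow> coprime k n \<Longrightarrow> poly u (zeta n k) \<noteq> 0"
  shows "coprime u (cyclotomic n)"
  unfolding cyclotomic_eq using assms by (intro prod_coprime_right coprime_linear_polyI) auto

lemma cyclotomic_dvd:
  assumes "n > 0" "\<And>k. k < n \<Longrightarrow> coprime k n \<Longrightarrow> poly u (zeta n k) = 0"
  shows "cyclotomic n dvd u"
proof -
  have "cyclotomic n = (\<Prod>c\<in>zeta n ` {k. k < n \<and> coprime k n}. [:- c, 1:])"
    unfolding cyclotomic_eq
    by (subst prod.reindex) (auto intro: inj_on_subset[OF inj_on_zeta[OF assms(1)]])
  then show ?thesis
    using assms(2) by (auto intro!: prod_linear_dvd)
qed

text \<open>Over the complex numbers the cyclotomic polynomial splits, so this ring inverts every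
  polynomial without zeros at the primitive \<open>n\<close>-th roots of unity; it need not have a
  single maximal ideal.\<close>

definition cyclotomic_local :: "nat \<Rightarrow> ratfun set" where
  "cyclotomic_local n = {to_fract u / to_fract v | u v. v \<noteq> 0 \<and> coprime v (cyclotomic n)}"

lemma cyclotomic_localI: "v \<noteq> 0 \<Longrightarrow> coprime v (cyclotomic n) \<Longrightarrow> to_fract u / to_fract v \<in> cyclotomic_local n"
  unfolding cyclotomic_local_def by blast

lemma to_fract_local: "to_fract u \<in> cyclotomic_local n"
  using cyclotomic_localI[of 1 n u] by simp

lemma inverse_to_fract_local: "v \<noteq> 0 \<Longrightarrow> coprime v (cyclotomic n) \<Longrightarrow> inverse (to_fract v) \<in> cyclotomic_local n"
  using cyclotomic_localI[of v n 1] by (simp add: divide_inverse)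

lemma cyclotomic_local_mult:
  assumes "x \<in> cyclotomic_local n" "y \<in> cyclotomic_local n"
  shows "x * y \<in> cyclotomic_local n"
proof -
  obtain u v u' v' where "x = to_fract u / to_fract v" "v \<noteq> 0" "coprime v (cyclotomic n)"
    "y = to_fract u' / to_fract v'" "v' \<noteq> 0" "coprime v' (cyclotomic n)"
    using assms unfolding cyclotomic_local_def by blast
  then show ?thesis
    using cyclotomic_localI[of "v * v'" n "u * u'"] by simp
qed

lemma cyclotomic_local_diff:
  assumes "x \<in> cyclotomic_local n" "y \<in> cyclotomic_local n"
  shows "x - y \<in> cyclotomic_local n"
proof -
  obtain u v u' v' where "x = to_fract u / to_fract v" "v \<noteq> 0" "coprime v (cyclotomic n)"
    "y = to_fract u' / to_fract v'" "v' \<noteq> 0" "coprime v' (cyclotomic n)"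
    using assms unfolding cyclotomic_local_def by blast
  then show ?thesis
    using cyclotomic_localI[of "v * v'" n "u * v' - u' * v"] by (simp add: diff_frac_eq)
qed

lemma qvar_power: "qvar ^ j = to_fract ([:0, 1:] ^ j)"
  by (simp add: qvar_def to_fract_power)

lemma qvar_neq_0: "qvar \<noteq> 0"
  by (simp add: qvar_def)

lemma qvar_power_neq_1: "0 < j \<Longrightarrow> qvar ^ j \<noteq> 1"
proof
  assume "0 < j" "qvar ^ j = 1"
  then have "to_fract ([:0, 1:] ^ j) = to_fract (1 :: complex poly)"
    by (simp add: qvar_power)
  then have "poly ([:0, 1:] ^ j) 0 = poly (1 :: complex poly) 0"
    by (simp only: to_fract_eq_iff)
  with \<open>0 < j\<close> show False by (simp add: poly_power zero_power)
qed

text \<open>The polynomial \<open>1 - [:0, 1:] ^ j\<close> vanishes at all primitive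
  \<open>n\<close>-th roots of unity if \<open>n\<close> divides \<open>j\<close> and at none
  otherwise. Negative exponents reduce to positive ones through \<open>neg\<close>, whose extra
  factor is a monomial.\<close>

lemma root_localization_qvar:
  assumes n: "n > 0"
  shows "root_localization (cyclotomic_local n) (to_fract (cyclotomic n)) qvar n"
proof
  let ?S = "cyclotomic_local n"
  have neg: "1 - qvar powi (- int j) = (0 - qvar powi (- int j)) * (1 - qvar ^ j)" for j
    using qvar_neq_0 by (simp add: power_int_minus right_diff_distrib)
  have X: "coprime [:0, 1:] (cyclotomic n)"
    by (rule coprime_cyclotomic) (simp add: zeta_def)
  have two: "to_fract (2 :: complex poly) = 2"
    unfolding one_add_one[symmetric] to_fract_add by simp
  show "1 \<in> ?S"
    using to_fract_local[of 1 n] by simp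
  have "coprime 2 (cyclotomic n)"
    by (rule coprime_cyclotomic) simp
  then show "inverse 2 \<in> ?S"
    unfolding two[symmetric] by (intro inverse_to_fract_local) simp_all
  show "qvar \<in> ?S"
    unfolding qvar_def by (rule to_fract_local)
  show iq: "inverse qvar \<in> ?S"
    unfolding qvar_def using X by (intro inverse_to_fract_local) simp_all
  have qinv: "qvar powi (- int j) \<in> ?S" for j
  proof -
    have "inverse qvar ^ j \<in> ?S"
      using iq \<open>1 \<in> ?S\<close> by (induction j) (simp_all add: cyclotomic_local_mult)
    then show ?thesis by (simp add: power_int_minus power_inverse)
  qed
  show "x - y \<in> ?S" "x * y \<in> ?S" if "x \<in> ?S" "y \<in> ?S" for x y
    using that cyclotomic_local_diff cyclotomic_local_mult by blast+
  show "(2 :: ratfun) \<noteq> 0"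
    unfolding two[symmetric] to_fract_eq_0_iff by simp
  show "qvar \<noteq> 0"
    by (rule qvar_neq_0)
  show "qvar powi i \<noteq> 1" if "i \<noteq> 0" for i
    using that qvar_power_neq_1 by (cases i rule: int_cases2) (auto simp: power_int_minus inverse_eq_1_iff)
  have one_minus: "1 - qvar ^ j = to_fract (1 - [:0, 1:] ^ j)" for j
    by (simp add: qvar_power)
  have zero: "0 \<in> ?S"
    using to_fract_local[of 0 n] by simp
  have vanish: "\<exists>z\<in>?S. 1 - qvar ^ j = to_fract (cyclotomic n) * z" if "n dvd j" for j
  proof -
    have "cyclotomic n dvd 1 - [:0, 1:] ^ j"
      using n that by (intro cyclotomic_dvd) (simp_all add: zeta_power_eq_1_iff)
    then obtain w where "1 - [:0, 1:] ^ j = cyclotomic n * w" ..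
    then show ?thesis
      unfolding one_minus using to_fract_local[of w n] by auto
  qed
  show "\<exists>z\<in>?S. 1 - qvar powi i = to_fract (cyclotomic n) * z" if i: "int n dvd i" for i
  proof (cases i rule: int_cases2)
    case (nonneg j)
    then show ?thesis using i vanish[of j] by simp
  next
    case (nonpos j)
    then obtain z where z: "z \<in> ?S" "1 - qvar ^ j = to_fract (cyclotomic n) * z"
      using i vanish[of j] by auto
    have "1 - qvar powi i = to_fract (cyclotomic n) * ((0 - qvar powi (- int j)) * z)"
      unfolding nonpos neg z(2) by (simp only: ac_simps)
    moreover have "(0 - qvar powi (- int j)) * z \<in> ?S"
      by (intro cyclotomic_local_mult cyclotomic_local_diff zero qinv z)
    ultimately show ?thesis by blast
  qed
  have unit: "inverse (1 - qvar ^ j) \<in> ?S" if "\<not> n dvd j" for j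
  proof -
    have "coprime (1 - [:0, 1:] ^ j) (cyclotomic n)"
      using n that by (intro coprime_cyclotomic) (simp add: zeta_power_eq_1_iff)
    moreover have "j > 0"
      using that by (cases j) simp_all
    then have "1 - qvar ^ j \<noteq> 0"
      using qvar_power_neq_1 by simp
    ultimately show ?thesis
      unfolding one_minus by (intro inverse_to_fract_local) auto
  qed
  show "inverse (1 - qvar powi i) \<in> ?S" if i: "\<not> int n dvd i" for i
  proof (cases i rule: int_cases2)
    case (nonneg j)
    then show ?thesis using i unit[of j] by simp
  next
    case (nonpos j)
    have "inverse (1 - qvar powi i) = (0 - qvar ^ j) * inverse (1 - qvar ^ j)"
      unfolding nonpos neg by (simp add: power_int_minus)
    moreover have "qvar ^ j \<in> ?S"
      unfolding qvar_power by (rule to_fract_local)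
    moreover have "\<not> n dvd j"
      using i nonpos by simp
    ultimately show ?thesis
      by (simp only: cyclotomic_local_mult cyclotomic_local_diff zero unit not_False_eq_True)
  qed
qed

theorem theorem7:
  fixes d r :: int and n :: nat
  assumes "d \<ge> 5" and "odd d" and "even r" and "gcd d r = 1"
    and "n > 1" and "odd n" and "int n mod d = (- r) mod d"
    and "int n \<ge> max r (d - r)"
  shows "ratfun_cong_zero
    (\<Sum>k<n. qint (qvar ^ 2) (2 * d * int k + r)
        * qpoch (qvar powi (2 * r)) (qvar powi (2 * d)) k ^ nat d
        / qpoch (qvar powi (2 * d)) (qvar powi (2 * d)) k ^ nat d
        * qvar powi (d * (d - r - 2) * int k))
    ((cyclotomic n) ^ 2)"
proof -
  let ?\<Phi> = "cyclotomic n"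
  have nat_d: "int (nat d) = d"
    using assms(1) by simp
  have "d dvd int n - (- r)"
    using assms(7) by (simp only: mod_eq_dvd_iff)
  then obtain s where "int n - (- r) = d * s" ..
  then have ns: "int n = d * s - r" by simp
  have "d * s = int n + r"
    using ns by simp
  \<comment> \<open>\<open>n\<close> is odd and \<open>r\<close> is even, so
    \<open>d * s = n + r\<close> forces \<open>s\<close> to be odd.\<close>
  then have "odd (d * s)"
    using assms(3,6) by simp
  then obtain m' where s: "s = 2 * m' + 1"
    by (meson even_mult_iff oddE)
  \<comment> \<open>Here \<open>n \<ge> d - r\<close> enters; it makes \<open>s\<close> positive and
    thus \<open>m\<close> a natural number.\<close>
  have "d * 1 \<le> d * s"
    using ns assms(8) by simp
  then have "1 \<le> s"
    using assms(1) by (simp add: mult_le_cancel_left)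
  then have "0 \<le> m'"
    using s by simp
  then obtain m where m: "m' = int m"
    by (rule nonneg_int_cases)
  \<comment> \<open>With \<open>r \<le> n\<close> this gives \<open>5 * s \<le> 2 * n\<close>, so
    \<open>n - s\<close> is nonnegative and its conversion to a natural number loses
    nothing.\<close>
  have "5 * s \<le> d * s"
    using \<open>1 \<le> s\<close> assms(1) by (intro mult_right_mono) auto
  then have "s \<le> int n"
    using ns assms(8) \<open>1 \<le> s\<close> by linarith
  interpret root_localization "cyclotomic_local n" "to_fract ?\<Phi>" qvar n
    using assms(5) by (intro root_localization_qvar) simp
  interpret W: well_poised_truncated "cyclotomic_local n" "to_fract ?\<Phi>" qvar n "nat d" m "nat (int n - s)" r
  proof
    show "odd (nat d)" using assms(2) nat_d by (metis even_of_nat)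
    show "coprime (int (nat d)) r" unfolding nat_d using assms(4) by (simp add: coprime_iff_gcd_eq_1)
    show "int n = int (nat d) * (2 * int m + 1) - r" unfolding nat_d using ns s m by simp
    show "int (nat (int n - s)) = int n - (2 * int m + 1)" using \<open>s \<le> int n\<close> s m by simp
  qed (use assms in auto)
  have a: "W.a = qvar powi (2 * r)" and Q: "W.Q = qvar powi (2 * d)" and Z: "W.Z = qvar powi (d * (d - r - 2))"
    unfolding W.a_def W.Q_def W.Z_def nat_d by (rule refl)+
  have "qint (qvar ^ 2) (2 * d * int k + r) * qpoch (qvar powi (2 * r)) (qvar powi (2 * d)) k ^ nat d
      / qpoch (qvar powi (2 * d)) (qvar powi (2 * d)) k ^ nat d * qvar powi (d * (d - r - 2) * int k)
      = inverse (1 - qvar powi 2) * W.T k" for k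
  proof -
    have "(qvar ^ 2) powi (2 * d * int k + r) = W.a * W.Q ^ (2 * k)"
      unfolding W.aQ power_int_power nat_d by (simp add: algebra_simps)
    then have "qint (qvar ^ 2) (2 * d * int k + r) = inverse (1 - qvar powi 2) * (1 - W.a * W.Q ^ (2 * k))"
      by (simp add: qint_def divide_inverse)
    moreover have "qvar powi (d * (d - r - 2) * int k) = W.Z ^ k"
      unfolding Z power_int_power' ..
    moreover have "qpoch W.Q W.Q k = (\<Prod>j<k. 1 - W.Q ^ (j + 1))" "qpoch W.a W.Q k = (\<Prod>j<k. 1 - W.a * W.Q ^ j)"
      by (simp_all add: qpoch_def)
    ultimately show ?thesis
      unfolding W.T_def a[symmetric] Q[symmetric] by (simp add: power_divide)
  qed
  then have sum_eq: "(\<Sum>k<n. qint (qvar ^ 2) (2 * d * int k + r) * qpoch (qvar powi (2 * r)) (qvar powi (2 * d)) k ^ nat d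
      / qpoch (qvar powi (2 * d)) (qvar powi (2 * d)) k ^ nat d * qvar powi (d * (d - r - 2) * int k))
      = inverse (1 - qvar powi 2) * (\<Sum>k<n. W.T k)" (is "?sum = _")
    by (simp only: sum_distrib_left)
  \<comment> \<open>This makes \<open>1 - q ^ 2\<close>, the denominator of the
    \<open>q\<close>-integers, a unit.\<close>
  have "\<not> int n dvd 2"
    using assms(5,6) by (auto dest!: zdvd_imp_le simp: le_less)
  then have "cg 2 ?sum 0"
    unfolding sum_eq by (intro cg_0_mult_left W.sum_T_cg_0 unit)
  then obtain z where "z \<in> cyclotomic_local n" and sum_z: "?sum = to_fract ?\<Phi> ^ 2 * z"
    unfolding cg_def diff_zero by blast
  then obtain u v where v: "v \<noteq> 0" "coprime v ?\<Phi>" and z: "z = to_fract u / to_fract v"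
    unfolding cyclotomic_local_def by blast
  have "?sum = to_fract (?\<Phi> ^ 2 * u) / to_fract v"
    unfolding sum_z z by (simp add: to_fract_power)
  moreover have "coprime v (?\<Phi> ^ 2)"
    using v(2) by simp
  moreover have "?\<Phi> ^ 2 dvd ?\<Phi> ^ 2 * u"
    by simp
  ultimately show ?thesis
    unfolding ratfun_cong_zero_def using v(1) by blast
qed

end
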